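(* For every anchored subset $X$ of $\mathbb{R}^2$ and every integer $k\geq 1$, there is a triangle-free family $\mathcal{F}$ of homothetic copies of $X$ in the plane such that $\chi(\mathcal{F})>k$.
   Context: The intersection graph of a family of sets $\mathcal{F}$ is the graph with vertex set $\mathcal{F}$ in which two distinct members are adjacent if and only if they intersect. A family is identified with its intersection graph: $\chi(\mathcal{F})$ is the chromatic number of the intersection graph, and $\mathcal{F}$ is triangle-free if no three distinct members pairwise intersect. A homothetic copy of $X$ is a set obtained from $X$ by uniform scaling (by a positive factor) and translation. A curve stabs an axis-aligned rectangle horizontally (vertically) if it is contained in that rectangle and connects its left and right (top and bottom, respectively) boundaries. A set $X\subset\mathbb{R}^2$ is anchored if it can be transformed by an (invertible) affine transformation of the plane to a set $X'$ with the following properties: (i) $X'$ is contained in the square $U=[0,1]\times(0,1)$ (open at the top and bottom). (ii) For every $\epsilon\in(0,1)$, there is a closed (axis-aligned) square $E(\epsilon)\subset U$ such that $E(\epsilon)$ is disjoint from $X'$, the width $\xi(\epsilon)$ of $E(\epsilon)$ (which is positive) satisfies $(1+\epsilon)\xi(\epsilon)<\epsilon$, and the distance between the right side of $E(\epsilon)$ and the right side of $U$ is equal to $\epsilon\,\xi(\epsilon)$. One such $E(\epsilon)$ is fixed for each $\epsilon$. (iii) For every $\epsilon\in(0,1)$, letting $V_L(\epsilon)$ be the rectangle formed by the top, bottom, and left sides of $U$ and the vertical line through the left side of $E(\epsilon)$, there is a curve in $X'$ that stabs $V_L(\epsilon)$ horizontally. (iv) For every $\epsilon\in(0,1)$, letting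 $V_R(\epsilon)$ be the rectangle formed by the lines through the top, bottom, and right sides of $E(\epsilon)$ and the right side of $U$, there is a curve in $X'$ that stabs $V_R(\epsilon)$ vertically. *)

theory Defs
  imports "HOL-Analysis.Analysis" "HOL-Library.Extended_Nat"
begin

definition proper_colouring :: "'v set \<Rightarrow> 'v set set \<Rightarrow> nat \<Rightarrow> ('v \<Rightarrow> nat) \<Rightarrow> bool" where
  "proper_colouring V E n c \<longleftrightarrow>
     c ` V \<subseteq> {..<n} \<and> (\<forall>u\<in>V. \<forall>v\<in>V. {u, v} \<in> E \<longrightarrow> c u \<noteq> c v)"

(* Graphs need not be finite; the value is infinity when no finite number of colours suffices. *)
definition chromatic_number :: "'v set \<Rightarrow> 'v set set \<Rightarrow> enat" where
  "chromatic_number V E = (INF n \<in> {n. \<exists>c. proper_colouring V E n c}. enat n)"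

definition intersection_edges :: "'a set set \<Rightarrow> 'a set set set" where
  "intersection_edges F = {{A, B} | A B. A \<in> F \<and> B \<in> F \<and> A \<noteq> B \<and> A \<inter> B \<noteq> {}}"

definition family_chromatic_number :: "'a set set \<Rightarrow> enat" where
  "family_chromatic_number F = chromatic_number F (intersection_edges F)"

definition triangle_free_family :: "'a set set \<Rightarrow> bool" where
  "triangle_free_family F \<longleftrightarrow>
     \<not> (\<exists>A\<in>F. \<exists>B\<in>F. \<exists>C\<in>F. A \<noteq> B \<and> B \<noteq> C \<and> A \<noteq> C \<and>
          A \<inter> B \<noteq> {} \<and> B \<inter> C \<noteq> {} \<and> A \<inter> C \<noteq> {})"

definition homothetic_copy :: "'a::real_vector set \<Rightarrow> 'a set \<Rightarrow> bool" where
  "homothetic_copy X Y \<longleftrightarrow> (\<exists>r>0. \<exists>c. Y = (\<lambda>x. r *\<^sub>R x + c) ` X)"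

definition invertible_affine :: "('a::real_vector \<Rightarrow> 'a) \<Rightarrow> bool" where
  "invertible_affine T \<longleftrightarrow> (\<exists>f c. linear f \<and> bij f \<and> T = (\<lambda>x. f x + c))"

(* A rectangle is given by its left, right, bottom and top coordinates, in this order.
   A curve is a path; by reversal its orientation is immaterial. *)
definition rectangle :: "real \<Rightarrow> real \<Rightarrow> real \<Rightarrow> real \<Rightarrow> (real \<times> real) set" where
  "rectangle l r b t = {l..r} \<times> {b..t}"

definition stabs_horizontally ::
    "(real \<Rightarrow> real \<times> real) \<Rightarrow> real \<Rightarrow> real \<Rightarrow> real \<Rightarrow> real \<Rightarrow> bool" where
  "stabs_horizontally g l r b t \<longleftrightarrow>
     path g \<and> path_image g \<subseteq> rectangle l r b t \<and>
     fst (pathstart g) = l \<and> fst (pathfinish g) = r"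

definition stabs_vertically ::
    "(real \<Rightarrow> real \<times> real) \<Rightarrow> real \<Rightarrow> real \<Rightarrow> real \<Rightarrow> real \<Rightarrow> bool" where
  "stabs_vertically g l r b t \<longleftrightarrow>
     path g \<and> path_image g \<subseteq> rectangle l r b t \<and>
     snd (pathstart g) = t \<and> snd (pathfinish g) = b"

definition unit_strip :: "(real \<times> real) set" where
  "unit_strip = {0..1} \<times> {0<..<1}"

(* The square E(eps) has lower left corner (a, b) and width w. *)
definition anchored_position :: "(real \<times> real) set \<Rightarrow> bool" where
  "anchored_position X' \<longleftrightarrow>
     X' \<subseteq> unit_strip \<and>
     (\<forall>\<epsilon>\<in>{0<..<1}. \<exists>a b w.
        w > 0 \<and>
        rectangle a (a + w) b (b + w) \<subseteq> unit_strip \<and>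
        rectangle a (a + w) b (b + w) \<inter> X' = {} \<and>
        (1 + \<epsilon>) * w < \<epsilon> \<and>
        1 - (a + w) = \<epsilon> * w \<and>
        (\<exists>g. path_image g \<subseteq> X' \<and> stabs_horizontally g 0 a 0 1) \<and>
        (\<exists>g. path_image g \<subseteq> X' \<and> stabs_vertically g (a + w) 1 b (b + w)))"

definition anchored :: "(real \<times> real) set \<Rightarrow> bool" where
  "anchored X \<longleftrightarrow> (\<exists>T. invertible_affine T \<and> anchored_position (T ` X))"

end

theory Submission
  imports Defs
begin

text \<open>
  Induction on the number \<open>k\<close> of colours, for families \<open>F\<close> with a set of pairwise disjoint probes.
  A probe is a horizontal strip reaching the right side of the unit square; it starts with a square
  core that avoids \<open>F\<close>, the rest of it is much thinner than the core, the members of \<open>F\<close> meeting it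
  are pairwise disjoint, and each of them crosses it from top to bottom. The invariant is that every
  proper colouring puts \<open>k\<close> colours on the members meeting some probe.

  For the step, put a copy of one such family (scaled a bit more to leave a gap on its right) into
  each core of another one. In the lower half of every inner probe \<open>Q\<close> put a copy \<open>D\<close> of \<open>X\<close> that
  starts in the core of \<open>Q\<close> and whose empty square \<open>E(\<epsilon>)\<close> lies in the gap; the horizontal curve
  of \<open>D\<close> meets all members crossing \<open>Q\<close>. The upper half of \<open>Q\<close> becomes a probe meeting exactly
  these members, and \<open>E(\<epsilon>)\<close> becomes the core of a probe meeting only \<open>D\<close>; both also meet
  the members crossing the outer probe. If the outer and inner probe see different sets of \<open>k\<close>
  colours, the upper probe sees \<open>k + 1\<close>; otherwise the colour of \<open>D\<close> is new and the lower one does.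
\<close>

section \<open>Squares, probes and configurations\<close>

text \<open>A triple \<open>(x, y, h)\<close> stands for the square of side \<open>h\<close> with lower left corner \<open>(x, y)\<close>, and
  also for the probe with this core and for the homothety that takes the unit square to the square.\<close>

fun core :: "real \<times> real \<times> real \<Rightarrow> (real \<times> real) set" where
  "core (x, y, h) = {x..x + h} \<times> {y..y + h}"

text \<open>Unbounded to the right, so that homotheties carry strips to strips and nested squares
  have nested strips.\<close>

fun strip :: "real \<times> real \<times> real \<Rightarrow> (real \<times> real) set" where
  "strip (x, y, h) = {x..} \<times> {y..y + h}"

text \<open>Since strips are unbounded to the right, two of them are disjoint exactly when their
  levels are.\<close>

fun levels :: "real \<times> real \<times> real \<Rightarrow> real set" where
  "levels (x, y, h) = {y..y + h}"

text \<open>The curve may leave the band at both ends and stays to the right of the core. Hence the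
  same curve serves every nested probe, and no subcurve has to be cut out.\<close>

fun crosses :: "(real \<times> real) set \<Rightarrow> real \<times> real \<times> real \<Rightarrow> bool" where
  "crosses A (x, y, h) \<longleftrightarrow> (\<exists>g. path g \<and> path_image g \<subseteq> A \<inter> {x + h..} \<times> UNIV \<and>
     y + h \<le> snd (pathstart g) \<and> snd (pathfinish g) \<le> y)"

text \<open>The last condition says that the part of the strip between the core and the right side
  of the unit square has width at most \<epsilon> times the side of the core.\<close>

fun probe :: "real \<Rightarrow> real \<times> real \<times> real \<Rightarrow> bool" where
  "probe \<epsilon> (x, y, h) \<longleftrightarrow> 0 < h \<and> 0 \<le> x \<and> x + h \<le> 1 \<and> 0 < y \<and> y + h < 1 \<and> 1 - (x + h) \<le> \<epsilon> * h"

fun nested :: "real \<times> real \<times> real \<Rightarrow> real \<times> real \<times> real \<Rightarrow> bool" where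
  "nested (x', y', h') (x, y, h) \<longleftrightarrow> 0 < h' \<and> x \<le> x' \<and> x' + h' \<le> x + h \<and> y \<le> y' \<and> y' + h' \<le> y + h"

fun place :: "real \<times> real \<times> real \<Rightarrow> real \<times> real \<Rightarrow> real \<times> real" where
  "place (x, y, h) z = h *\<^sub>R z + (x, y)"

text \<open>Composition of homotheties: \<open>place (comb p r)\<close> is \<open>place p\<close>
  after \<open>place r\<close>.\<close>

fun comb :: "real \<times> real \<times> real \<Rightarrow> real \<times> real \<times> real \<Rightarrow> real \<times> real \<times> real" where
  "comb (x, y, h) (x', y', h') = (x + h * x', y + h * y', h * h')"

definition met :: "(real \<times> real) set set \<Rightarrow> real \<times> real \<times> real \<Rightarrow> (real \<times> real) set set" where
  "met F p = {A \<in> F. A \<inter> strip p \<noteq> {}}"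

definition config :: "(real \<times> real) set \<Rightarrow> real \<Rightarrow> (real \<times> real) set set \<Rightarrow>
    (real \<times> real \<times> real) set \<Rightarrow> bool" where
  "config X \<epsilon> F P \<longleftrightarrow> finite F \<and> finite P \<and>
     (\<forall>A\<in>F. homothetic_copy X A \<and> A \<subseteq> unit_strip) \<and>
     triangle_free_family F \<and>
     (\<forall>p\<in>P. probe \<epsilon> p) \<and>
     (\<forall>p\<in>P. \<forall>A\<in>F. A \<inter> core p = {}) \<and>
     (\<forall>p\<in>P. \<forall>A\<in>met F p. crosses A p) \<and>
     (\<forall>p\<in>P. pairwise disjnt (met F p)) \<and>
     (\<forall>p\<in>P. \<forall>q\<in>P. p \<noteq> q \<longrightarrow> levels p \<inter> levels q = {})"

text \<open>Colourings with no bound on the number of colours; the bound enters only when the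
  chromatic number is estimated.\<close>

definition proper :: "'a set set \<Rightarrow> ('a set \<Rightarrow> nat) \<Rightarrow> bool" where
  "proper F c \<longleftrightarrow> (\<forall>A\<in>F. \<forall>B\<in>F. A \<noteq> B \<longrightarrow> A \<inter> B \<noteq> {} \<longrightarrow> c A \<noteq> c B)"

definition forces :: "nat \<Rightarrow> (real \<times> real) set set \<Rightarrow> (real \<times> real \<times> real) set \<Rightarrow> bool" where
  "forces k F P \<longleftrightarrow> (\<forall>c. proper F c \<longrightarrow> (\<exists>p\<in>P. k \<le> card (c ` met F p)))"

text \<open>\<open>S\<close> stands for the colours that the outer probe already sees.\<close>
definition extends :: "nat \<Rightarrow> (real \<times> real) set set \<Rightarrow> (real \<times> real \<times> real) set \<Rightarrow> bool" where
  "extends k F P \<longleftrightarrow> (\<forall>c S. proper F c \<longrightarrow> finite S \<longrightarrow> k \<le> card S \<longrightarrow>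
     (\<exists>p\<in>P. Suc k \<le> card (S \<union> c ` met F p)))"

section \<open>Effect of homotheties and nesting on copies, probes and colourings\<close>

lemma homothetic_copy_place:
  assumes "homothetic_copy X A" "0 < snd (snd p)"
  shows "homothetic_copy X (place p ` A)"
proof -
  obtain x y h where p: "p = (x, y, h)" by (cases p)
  obtain r c where rc: "r > 0" "A = (\<lambda>z. r *\<^sub>R z + c) ` X"
    using assms by (auto simp: homothetic_copy_def)
  have "place p ` A = (\<lambda>z. (h * r) *\<^sub>R z + (h *\<^sub>R c + (x, y))) ` X"
    unfolding rc image_image p by (intro image_cong) (auto simp: algebra_simps)
  then show ?thesis
    unfolding homothetic_copy_def using rc assms p by (metis mult_pos_pos snd_conv)
qed

lemma homothetic_copy_refl: "homothetic_copy X X"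
  unfolding homothetic_copy_def by (rule exI[of _ 1]) (auto intro!: exI[of _ 0])

lemma inj_place: "0 < snd (snd p) \<Longrightarrow> inj (place p)"
  by (cases p) (auto simp: inj_def)

lemma
  assumes "0 < snd (snd p)"
  shows place_mem_core: "place p z \<in> core (comb p r) \<longleftrightarrow> z \<in> core r"
    and place_mem_strip: "place p z \<in> strip (comb p r) \<longleftrightarrow> z \<in> strip r"
  using assms by (cases p; cases r; cases z; simp flip: distrib_left)+

lemma place_core_Int:
  "0 < snd (snd p) \<Longrightarrow> place p ` A \<inter> core (comb p r) = {} \<longleftrightarrow> A \<inter> core r = {}"
  using place_mem_core[of p _ r] by blast

lemma place_strip_Int:
  "0 < snd (snd p) \<Longrightarrow> place p ` A \<inter> strip (comb p r) = {} \<longleftrightarrow> A \<inter> strip r = {}"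
  using place_mem_strip[of p _ r] by blast

lemma comb_levels_Int:
  assumes "0 < snd (snd p)" "levels r \<inter> levels r' = {}"
  shows "levels (comb p r) \<inter> levels (comb p r') = {}"
proof (rule ccontr)
  assume "levels (comb p r) \<inter> levels (comb p r') \<noteq> {}"
  then obtain t where t: "t \<in> levels (comb p r)" "t \<in> levels (comb p r')" by blast
  \<comment> \<open>The preimage of the common level under the homothety
    \<open>place p\<close>.\<close>
  define u where "u = (t - fst (snd p)) / snd (snd p)"
  have "t = fst (snd p) + snd (snd p) * u" using assms by (simp add: u_def)
  then have "u \<in> levels r" "u \<in> levels r'"
    using t assms by (cases p; cases r; cases r'; simp add: add.assoc flip: distrib_left)+
  with assms show False by blast
qed

lemma place_unit_strip_core: "0 < snd (snd p) \<Longrightarrow> A \<subseteq> unit_strip \<Longrightarrow> place p ` A \<subseteq> core p"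
  by (cases p) (force simp: unit_strip_def mult_left_le)

lemma probe_pos: "probe \<epsilon> p \<Longrightarrow> 0 < snd (snd p)"
  by (cases p) auto

lemma core_subset_unit_strip: "probe \<epsilon> p \<Longrightarrow> core p \<subseteq> unit_strip"
  by (cases p) (auto simp: unit_strip_def)

lemma strip_levels: "z \<in> strip p \<Longrightarrow> snd z \<in> levels p"
  by (cases p) auto

lemma core_strip: "core p \<subseteq> strip p"
  by (cases p) auto

lemma nested_comb:
  assumes "0 < snd (snd p)" "probe \<epsilon> r"
  shows "nested (comb p r) p"
proof -
  obtain x y h where p: "p = (x, y, h)" by (cases p)
  obtain x' y' h' where r: "r = (x', y', h')" by (cases r)
  have "h * x' + h * h' \<le> h" "h * y' + h * h' \<le> h"
    using assms r p by (auto simp flip: distrib_left simp: mult_left_le)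
  then show ?thesis using assms r p by auto
qed

lemma nested_core: "nested q p \<Longrightarrow> core q \<subseteq> core p"
  and nested_strip: "nested q p \<Longrightarrow> strip q \<subseteq> strip p"
  and nested_levels: "nested q p \<Longrightarrow> levels q \<subseteq> levels p"
  by (cases p; cases q; auto)+

lemma nested_crosses: "nested q p \<Longrightarrow> crosses A p \<Longrightarrow> crosses A q"
  by (cases p; cases q) fastforce

text \<open>By the intermediate value theorem the crossing curve attains the bottom level
  \<open>y\<close>, and it does so to the right of the core.\<close>

lemma crosses_meets_strip:
  assumes "crosses A p" "probe \<epsilon> p"
  shows "A \<inter> strip p \<noteq> {}"
proof -
  obtain x y h where p: "p = (x, y, h)" by (cases p)
  from assms p obtain g where g: "path g" "path_image g \<subseteq> A \<inter> {x + h..} \<times> UNIV"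
    "y + h \<le> snd (pathstart g)" "snd (pathfinish g) \<le> y" by auto
  have "connected (snd ` path_image g)"
    using g(1) by (intro connected_continuous_image continuous_intros connected_path_image)
  moreover have "snd (pathstart g) \<in> snd ` path_image g" "snd (pathfinish g) \<in> snd ` path_image g"
    by auto
  ultimately have "y \<in> snd ` path_image g"
    using connectedD_interval[of "snd ` path_image g" "snd (pathfinish g)" "snd (pathstart g)" y] g assms p by auto
  then obtain u where "(u, y) \<in> path_image g" by auto
  then have "(u, y) \<in> A \<inter> strip p" using g(2) p assms by auto
  then show ?thesis by blast
qed

lemma crosses_place:
  assumes "0 < snd (snd p)" "crosses A r"
  shows "crosses (place p ` A) (comb p r)"
proof -
  obtain x y h where p: "p = (x, y, h)" by (cases p)
  with assms have h: "0 < h" by simp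
  obtain x' y' h' where r: "r = (x', y', h')" by (cases r)
  from assms r obtain g where g: "path g" "path_image g \<subseteq> A \<inter> {x' + h'..} \<times> UNIV"
    "y' + h' \<le> snd (pathstart g)" "snd (pathfinish g) \<le> y'" by auto
  have "path (place p \<circ> g)"
    using g(1) unfolding path_def comp_def p place.simps by (intro continuous_intros)
  moreover have "path_image (place p \<circ> g) \<subseteq> place p ` A \<inter> {x + h * x' + h * h'..} \<times> UNIV"
    unfolding path_image_compose p using g(2) h
    by (force simp flip: distrib_left simp: add.assoc)
  moreover have "y + h * y' + h * h' \<le> snd (pathstart (place p \<circ> g))"
    using g(3) h by (auto simp: p pathstart_compose add.assoc simp flip: distrib_left)
  moreover have "snd (pathfinish (place p \<circ> g)) \<le> y + h * y'"
    using g(4) h by (auto simp: p pathfinish_compose)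
  ultimately show ?thesis unfolding r p by (auto simp del: place.simps)
qed

lemma image_Int_empty_iff: "inj \<phi> \<Longrightarrow> \<phi> ` A \<inter> \<phi> ` B = {} \<longleftrightarrow> A \<inter> B = {}"
  by (metis image_Int image_is_empty)

lemma triangle_free_familyD:
  assumes "triangle_free_family F" "A \<in> F" "B \<in> F" "C \<in> F" "A \<noteq> B" "B \<noteq> C" "A \<noteq> C"
    "A \<inter> B \<noteq> {}" "B \<inter> C \<noteq> {}" "A \<inter> C \<noteq> {}"
  shows False
  using assms unfolding triangle_free_family_def by blast

lemma triangle_free_family_image:
  assumes "inj \<phi>" "triangle_free_family F"
  shows "triangle_free_family ((`) \<phi> ` F)"
  using assms unfolding triangle_free_family_def
  by (simp add: image_Int_empty_iff inj_image_eq_iff)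

text \<open>Sharper than \<open>place_unit_strip_core\<close>: the open top and bottom of
  \<open>unit_strip\<close> keep a copy strictly inside the band of its box.\<close>

lemma place_unit_strip:
  assumes "0 < h" "A \<subseteq> unit_strip"
  shows "place (x, y, h) ` A \<subseteq> {x..x + h} \<times> {y<..<y + h}"
  using assms by (force simp: unit_strip_def mult_left_le)

text \<open>An injective map preserves distinctness and intersections, so a colouring pulls back.
  This serves both the placed copies and the final affine map.\<close>

lemma proper_place:
  assumes "proper H c" "(`) \<phi> ` F \<subseteq> H" "inj \<phi>"
  shows "proper F (\<lambda>A. c (\<phi> ` A))"
  using assms unfolding proper_def
  by (smt (verit) image_Int image_is_empty image_subset_iff inj_image_eq_iff)

lemma proper_subset: "proper H c \<Longrightarrow> F \<subseteq> H \<Longrightarrow> proper F c"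
  by (auto simp: proper_def)

lemma levels_disjoint:
  assumes "A \<inter> B \<noteq> {}" "A \<subseteq> strip p" "B \<subseteq> strip q"
  shows "levels p \<inter> levels q \<noteq> {}"
  using assms strip_levels by blast

section \<open>Crossing curves\<close>

text \<open>Clamping the second coordinate of the vertical curve into the band fits both curves into
  one box without creating crossings, as the horizontal curve avoids the ends of the band.\<close>
lemma curves_cross:
  fixes f g :: "real \<Rightarrow> real \<times> real"
  assumes f: "path f" "path_image f \<subseteq> {l..e} \<times> {b<..<t}" "fst (pathstart f) = l" "fst (pathfinish f) = e"
    and g: "path g" "path_image g \<subseteq> {l..e} \<times> UNIV" "t \<le> snd (pathstart g)" "snd (pathfinish g) \<le> b"
  shows "path_image f \<inter> path_image g \<noteq> {}"
proof -
  have "pathstart f \<in> path_image f" by (rule pathstart_in_path_image)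
  with f(2) have bt: "b < t" by (cases "pathstart f") force
  have ne: "(2::2) \<noteq> 1" by simp
  \<comment> \<open>Transfer to \<open>real^2\<close>, where \<open>fashoda\<close> is
    stated.\<close>
  define q where "q = (\<lambda>z::real\<times>real. (\<chi> i. if i = 1 then fst z else snd z) :: real^2)"
  define cl where "cl = (\<lambda>z::real\<times>real. (fst z, max b (min t (snd z))))"
  define lo where "lo = q (l, b)"
  define hi where "hi = q (e, t)"
  have q: "q z $ 1 = fst z" "q z $ 2 = snd z" for z
    by (auto simp: q_def)
  have "continuous_on S (\<lambda>z::real\<times>real. if i = 1 then fst z else snd z)" for S and i :: 2
    by (cases "i = 1") (auto intro!: continuous_intros)
  then have "continuous_on S q" for S
    unfolding q_def by (rule continuous_on_vec_lambda)
  then have path_q: "path (q \<circ> h)" if "path h" for h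
    using that path_continuous_image by blast
  have "path (cl \<circ> g)"
    using g(1) unfolding cl_def path_def comp_def by (auto intro!: continuous_intros)
  \<comment> \<open>\<open>fashoda\<close> takes the second curve from bottom to top, hence the
    reversal.\<close>
  then have 1: "path (q \<circ> f)" "path (q \<circ> reversepath (cl \<circ> g))"
    using f(1) by (auto intro: path_q)
  have 2: "path_image (q \<circ> f) \<subseteq> cbox lo hi" "path_image (q \<circ> reversepath (cl \<circ> g)) \<subseteq> cbox lo hi"
    using f(2) g(2) bt
    by (force simp: path_image_compose lo_def hi_def mem_box_cart forall_2 q cl_def)+
  have 3: "pathstart (q \<circ> f) $ 1 = lo $ 1" "pathfinish (q \<circ> f) $ 1 = hi $ 1"
    "pathstart (q \<circ> reversepath (cl \<circ> g)) $ 2 = lo $ 2"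
    "pathfinish (q \<circ> reversepath (cl \<circ> g)) $ 2 = hi $ 2"
    using f g bt by (auto simp: pathstart_compose pathfinish_compose lo_def hi_def q cl_def)
  obtain z where z: "z \<in> path_image (q \<circ> f)" "z \<in> path_image (q \<circ> reversepath (cl \<circ> g))"
    using fashoda[OF 1 2 3] by blast
  then obtain u v where uv: "u \<in> path_image f" "v \<in> path_image g" "q u = q (cl v)"
    by (auto simp: path_image_compose)
  have "fst u = fst v" "snd u = max b (min t (snd v))"
    using arg_cong[OF uv(3), of "\<lambda>w. w $ 1"] arg_cong[OF uv(3), of "\<lambda>w. w $ 2"]
    by (auto simp: q cl_def)
  moreover have "b < snd u" "snd u < t"
    using f(2) uv(1) by force+
  ultimately have "u = v"
    by (auto simp: prod_eq_iff max_def min_def split: if_splits)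
  with uv show ?thesis by blast
qed

section \<open>Inserting copies of one configuration into the cores of another\<close>

lemma configD:
  assumes "config X \<epsilon> F P"
  shows config_finite: "finite F" "finite P"
    and config_copy: "\<And>A. A \<in> F \<Longrightarrow> homothetic_copy X A"
    and config_unit_strip: "\<And>A. A \<in> F \<Longrightarrow> A \<subseteq> unit_strip"
    and config_triangle_free: "triangle_free_family F"
    and config_probe: "\<And>p. p \<in> P \<Longrightarrow> probe \<epsilon> p"
    and config_core: "\<And>p A. p \<in> P \<Longrightarrow> A \<in> F \<Longrightarrow> A \<inter> core p = {}"
    and config_crosses: "\<And>p A. p \<in> P \<Longrightarrow> A \<in> met F p \<Longrightarrow> crosses A p"
    and config_disjnt: "\<And>p A B. p \<in> P \<Longrightarrow> A \<in> met F p \<Longrightarrow> B \<in> met F p \<Longrightarrow> A \<noteq> B \<Longrightarrow> A \<inter> B = {}"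
    and config_levels: "\<And>p q. p \<in> P \<Longrightarrow> q \<in> P \<Longrightarrow> levels p \<inter> levels q \<noteq> {} \<Longrightarrow> p = q"
  using assms unfolding config_def by (simp_all add: pairwise_def disjnt_def) blast

text \<open>The right margin of a combined probe is the margin of the outer probe plus the scaled
  margin of the inner one. With \<open>h\<close> the inner side, the last assumption makes the sum
  at most \<epsilon> times the side of the combined core.\<close>

lemma config_insert:
  assumes F: "config X \<epsilon>1 F P" "forces k F P"
    and G: "config X \<epsilon>2 G R" "extends k G R"
    and \<epsilon>: "\<And>x y h. (x, y, h) \<in> R \<Longrightarrow> \<epsilon>1 \<le> h * (\<epsilon> - \<epsilon>2)"
  shows "\<exists>H Q. config X \<epsilon> H Q \<and> forces (Suc k) H Q"
proof -
  define H where "H = F \<union> (\<Union>p\<in>P. (`) (place p) ` G)"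
  define Q where "Q = (\<lambda>(p, r). comb p r) ` (P \<times> R)"
  have ppos: "0 < snd (snd p)" if "p \<in> P" for p
    using config_probe[OF F(1) that] by (rule probe_pos)
  have pcore: "place p ` A \<subseteq> core p" if "p \<in> P" "A \<in> G" for p A
    using ppos[OF that(1)] config_unit_strip[OF G(1) that(2)] by (rule place_unit_strip_core)
  have nst: "nested (comb p r) p" if "p \<in> P" "r \<in> R" for p r
    using ppos[OF that(1)] config_probe[OF G(1) that(2)] by (rule nested_comb)
  have plev: "p = q" if "p \<in> P" "q \<in> P" "levels p \<inter> levels q \<noteq> {}" for p q
    using config_levels[OF F(1)] that by blast
  have prb: "probe \<epsilon> (comb p r)" if pr: "p \<in> P" "r \<in> R" for p r
  proof -
    obtain x y h where p: "p = (x, y, h)" by (cases p)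
    obtain x' y' h' where r: "r = (x', y', h')" by (cases r)
    have 1: "probe \<epsilon>1 (x, y, h)" "probe \<epsilon>2 (x', y', h')" using config_probe[OF F(1) pr(1)] config_probe[OF G(1) pr(2)] p r by auto
    then have h: "0 < h" "0 < h'" by auto
    have "\<epsilon>1 \<le> h' * (\<epsilon> - \<epsilon>2)" using \<epsilon> pr r by blast
    then have "h * \<epsilon>1 + h * (\<epsilon>2 * h') \<le> h * (h' * (\<epsilon> - \<epsilon>2)) + h * (\<epsilon>2 * h')"
      using h by auto
    also have "\<dots> = \<epsilon> * (h * h')" by (simp add: algebra_simps)
    moreover have "1 - (x + h) \<le> h * \<epsilon>1" "h * (1 - (x' + h')) \<le> h * (\<epsilon>2 * h')"
      using 1 h by (auto simp: mult.commute)
    moreover have "0 \<le> h * x'" "0 < h * y'" using 1 h by auto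
    ultimately show ?thesis
      using nst[OF pr] 1 unfolding p r by (auto simp: algebra_simps)
  qed
  \<comment> \<open>Members of \<open>F\<close> met by \<open>p\<close> cross the nested probe as
    well, while copies placed in other cores lie at other levels.\<close>
  have met_eq: "met H (comb p r) = met F p \<union> (`) (place p) ` met G r" if pr: "p \<in> P" "r \<in> R" for p r
  proof (intro equalityI subsetI)
    fix A assume A: "A \<in> met H (comb p r)"
    then consider "A \<in> F" | q B where "q \<in> P" "B \<in> G" "A = place q ` B"
      by (auto simp: H_def met_def)
    then show "A \<in> met F p \<union> (`) (place p) ` met G r"
    proof cases
      case 1
      then show ?thesis using A nested_strip[OF nst[OF pr]] by (auto simp: met_def)
    next
      case 2
      have "levels q \<inter> levels p \<noteq> {}"
      proof (rule levels_disjoint)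
        show "A \<inter> strip p \<inter> strip p \<noteq> {}"
          using A nested_strip[OF nst[OF pr]] by (auto simp: met_def)
        show "A \<inter> strip p \<subseteq> strip q" using 2 pcore[OF 2(1,2)] core_strip[of q] by blast
      qed simp
      then have "q = p" using plev pr 2 by blast
      then show ?thesis using A 2 place_strip_Int[OF ppos[OF pr(1)], of _ r] pr unfolding met_def by blast
    qed
  next
    fix A assume "A \<in> met F p \<union> (`) (place p) ` met G r"
    then show "A \<in> met H (comb p r)"
    proof
      assume A: "A \<in> met F p"
      then have "crosses A (comb p r)" using config_crosses[OF F(1)] pr nst nested_crosses by blast
      then show ?thesis using A crosses_meets_strip prb[OF pr] by (auto simp: met_def H_def)
    next
      assume "A \<in> (`) (place p) ` met G r"
      then show ?thesis using place_strip_Int[OF ppos[OF pr(1)], of _ r] pr unfolding met_def H_def by blast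
    qed
  qed
  have FG: "A \<inter> place p ` B = {}" if "A \<in> F" "p \<in> P" "B \<in> G" for A B p
    using pcore[OF that(2,3)] config_core[OF F(1) that(2,1)] by blast
  have GG: "p = q" if "p \<in> P" "B \<in> G" "q \<in> P" "C \<in> G" "place p ` B \<inter> place q ` C \<noteq> {}" for p q B C
    using levels_disjoint[OF that(5), of p q] pcore[OF that(1,2)] pcore[OF that(3,4)]
      core_strip[of p] core_strip[of q] plev[OF that(1,3)] by blast
  have place_Int: "place p ` B \<inter> place p ` C = {} \<longleftrightarrow> B \<inter> C = {}" if "p \<in> P" for p B C
    using inj_place[OF ppos[OF that]] by (metis image_Int image_is_empty)
  have "config X \<epsilon> H Q"
    unfolding config_def
  proof (intro conjI ballI impI)
    show "finite H" "finite Q" using config_finite[OF F(1)] config_finite[OF G(1)] by (auto simp: H_def Q_def)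
  next
    have "homothetic_copy X A \<and> A \<subseteq> unit_strip" if "A \<in> H" for A
    proof -
      from that consider "A \<in> F" | q B where "q \<in> P" "B \<in> G" "A = place q ` B"
        by (auto simp: H_def)
      then show ?thesis
      proof cases
        case 1
        then show ?thesis using config_copy[OF F(1)] config_unit_strip[OF F(1)] by blast
      next
        case 2
        then show ?thesis
          using homothetic_copy_place[OF config_copy[OF G(1) 2(2)] ppos[OF 2(1)]] pcore[OF 2(1,2)]
            core_subset_unit_strip[OF config_probe[OF F(1) 2(1)]] by blast
      qed
    qed
    then show "homothetic_copy X A" "A \<subseteq> unit_strip" if "A \<in> H" for A
      using that by blast+
  next
    show "triangle_free_family H"
      unfolding triangle_free_family_def
    proof (intro notI, elim bexE conjE)
      fix A B C assume H: "A \<in> H" "B \<in> H" "C \<in> H" and ne: "A \<noteq> B" "B \<noteq> C" "A \<noteq> C"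
        and int: "A \<inter> B \<noteq> {}" "B \<inter> C \<noteq> {}" "A \<inter> C \<noteq> {}"
      \<comment> \<open>\<open>F\<close> avoids the cores and copies in different cores are
        disjoint, so a triangle lies within \<open>F\<close> or within a single copy of
        \<open>G\<close>.\<close>
      have "A \<in> F \<or> (\<exists>p\<in>P. \<exists>A'\<in>G. A = place p ` A')" using H by (auto simp: H_def)
      then show False
      proof (elim disjE bexE)
        assume A: "A \<in> F"
        then have "B \<in> F" "C \<in> F" using FG int H unfolding H_def by blast+
        with A ne int config_triangle_free[OF F(1)] show False unfolding triangle_free_family_def by blast
      next
        fix p A' assume A: "p \<in> P" "A' \<in> G" "A = place p ` A'"
        have "\<exists>B'\<in>G. D = place p ` B'" if D: "D \<in> H" "A \<inter> D \<noteq> {}" for D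
          using D FG[of D p A'] GG[of p A'] A unfolding H_def by blast
        then obtain B' C' where "B' \<in> G" "B = place p ` B'" "C' \<in> G" "C = place p ` C'"
          using H int by metis
        with A ne int config_triangle_free[OF G(1)] show False
          unfolding triangle_free_family_def by (metis place_Int)
      qed
    qed
  next
    fix q assume "q \<in> Q"
    then obtain p r where pr: "p \<in> P" "r \<in> R" and q: "q = comb p r" by (auto simp: Q_def)
    show "probe \<epsilon> q" using prb pr q by blast
    show "A \<inter> core q = {}" if "A \<in> H" for A
    proof (rule ccontr)
      assume ne: "A \<inter> core q \<noteq> {}"
      then have "A \<in> met H (comb p r)" using that core_strip[of q] unfolding met_def q by blast
      then consider "A \<in> F" | B where "B \<in> G" "A = place p ` B"
        unfolding met_eq[OF pr] by (auto simp: met_def)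
      then show False
      proof cases
        case 1
        then show ?thesis using ne nested_core[OF nst[OF pr]] config_core[OF F(1)] pr q by blast
      next
        case 2
        then show ?thesis using ne place_core_Int[OF ppos] config_core[OF G(1)] pr q by blast
      qed
    qed
    show "crosses A q" if "A \<in> met H q" for A
      using that config_crosses[OF F(1)] config_crosses[OF G(1)] pr nst nested_crosses crosses_place[OF ppos] unfolding q met_eq[OF pr] by blast
    have "A \<inter> B = {}" if "A \<in> met F p \<union> (`) (place p) ` met G r" "B \<in> met F p \<union> (`) (place p) ` met G r" "A \<noteq> B" for A B
    proof -
      have sub: "met F p \<subseteq> F" "met G r \<subseteq> G" by (auto simp: met_def)
      note d = config_disjnt[OF F(1) pr(1)] config_disjnt[OF G(1) pr(2)]
      from that(1,2) show ?thesis
      proof (elim UnE imageE)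
        assume "A \<in> met F p" "B \<in> met F p"
        then show ?thesis using d(1) that(3) by blast
      next
        fix A' B' assume "A = place p ` A'" "A' \<in> met G r" "B = place p ` B'" "B' \<in> met G r"
        then show ?thesis using d(2)[of A' B'] that(3) place_Int[OF pr(1), of A' B'] by blast
      next
        fix A' assume "A = place p ` A'" "A' \<in> met G r" "B \<in> met F p"
        then show ?thesis using FG[of B p A'] pr(1) sub by blast
      next
        fix B' assume "A \<in> met F p" "B = place p ` B'" "B' \<in> met G r"
        then show ?thesis using FG[of A p B'] pr(1) sub by blast
      qed
    qed
    then show "pairwise disjnt (met H q)"
      unfolding q met_eq[OF pr] pairwise_def disjnt_def by blast
    fix q' assume "q' \<in> Q" "q \<noteq> q'"
    then obtain p' r' where pr': "p' \<in> P" "r' \<in> R" and q': "q' = comb p' r'" by (auto simp: Q_def)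
    show "levels q \<inter> levels q' = {}"
    proof (cases "p = p'")
      case True
      then have "levels r \<inter> levels r' = {}" using \<open>q \<noteq> q'\<close> q q' config_levels[OF G(1)] pr pr' by blast
      then show ?thesis
        using comb_levels_Int ppos[OF pr(1)] True unfolding q q' by blast
    next
      case False
      then have "levels p \<inter> levels p' = {}" using plev pr pr' by blast
      then show ?thesis using nested_levels nst pr pr' q q' by blast
    qed
  qed
  moreover have "forces (Suc k) H Q"
    unfolding forces_def
  proof (intro allI impI)
    fix c assume c: "proper H c"
    then have "proper F c" by (rule proper_subset) (auto simp: H_def)
    then obtain p where p: "p \<in> P" "k \<le> card (c ` met F p)" using F(2) by (auto simp: forces_def)
    \<comment> \<open>The colouring restricted to the copy in the core of \<open>p\<close>;
      \<open>extends\<close> is applied with \<open>S\<close> the colours of the members of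
      \<open>F\<close> met by \<open>p\<close>.\<close>
    have "proper G (\<lambda>A. c (place p ` A))"
      using c inj_place[OF ppos] p by (intro proper_place[of H]) (auto simp: H_def)
    moreover have "finite (c ` met F p)" using config_finite(1)[OF F(1)] by (simp add: met_def)
    ultimately obtain r where "r \<in> R" "Suc k \<le> card (c ` met F p \<union> (\<lambda>A. c (place p ` A)) ` met G r)"
      using G(2) p unfolding extends_def by meson
    then show "\<exists>q\<in>Q. Suc k \<le> card (c ` met H q)"
      using p by (intro bexI[of _ "comb p r"]) (auto simp: met_eq Q_def image_Un image_image)
  qed
  ultimately show ?thesis by blast
qed

text \<open>Finitely many positive sides have a positive minimum. Inserting \<open>1\<close> covers
  empty \<open>P\<close> and gives \<open>\<eta> \<le> 1\<close>.\<close>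

lemma config_width_bound:
  assumes "config X \<epsilon> F P"
  obtains \<eta> where "0 < \<eta>" "\<eta> \<le> 1" "\<And>x y h. (x, y, h) \<in> P \<Longrightarrow> \<eta> \<le> h"
proof
  let ?S = "insert 1 ((\<lambda>p. snd (snd p)) ` P)"
  have S: "finite ?S" using config_finite[OF assms] by simp
  show "0 < Min ?S"
    using S config_probe[OF assms] probe_pos by (subst Min_gr_iff) auto
  show "Min ?S \<le> 1" using S by simp
  show "Min ?S \<le> h" if "(x, y, h) \<in> P" for x y h
    using S that by (intro Min_le) force+
qed

section \<open>Adding one new copy for each probe and splitting the probe in two\<close>

lemma config_extend:
  assumes X: "anchored_position X"
    and F: "config X (\<epsilon> / 8) F P" "forces k F P"
    and \<epsilon>: "0 < \<epsilon>" "\<epsilon> \<le> 1"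
  shows "\<exists>G R. config X \<epsilon> G R \<and> extends k G R"
proof -
  obtain \<eta> where \<eta>: "0 < \<eta>" "\<eta> \<le> 1" "\<And>x y h. (x, y, h) \<in> P \<Longrightarrow> \<eta> \<le> h"
    using config_width_bound[OF F(1)] by blast
  \<comment> \<open>\<delta> is both the width of the gap on the right and the parameter of the
    empty square of \<open>X\<close>. It is small compared with every core of
    \<open>P\<close>.\<close>
  define \<delta> where "\<delta> = \<epsilon> * \<eta> / 32"
  define \<sigma> where "\<sigma> = 1 - \<delta>"
  have "\<epsilon> * \<eta> \<le> 1 * 1" using \<epsilon> \<eta> by (intro mult_mono) auto
  then have \<delta>: "0 < \<delta>" "\<delta> \<le> 1 / 32" using \<epsilon> \<eta> by (auto simp: \<delta>_def)
  have "\<epsilon> * \<eta> \<le> \<epsilon> * 1" using \<epsilon> \<eta> by (intro mult_left_mono) auto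
  then have \<delta>\<epsilon>: "\<delta> \<le> \<epsilon>" using \<epsilon> unfolding \<delta>_def by linarith
  have \<sigma>: "31 / 32 \<le> \<sigma>" "\<sigma> < 1" using \<delta> by (auto simp: \<sigma>_def)
  from X have Xu: "X \<subseteq> unit_strip" by (simp add: anchored_position_def)
  obtain a b w g1 g2 where E: "w > 0" "rectangle a (a + w) b (b + w) \<subseteq> unit_strip"
      "rectangle a (a + w) b (b + w) \<inter> X = {}" "(1 + \<delta>) * w < \<delta>" "1 - (a + w) = \<delta> * w"
    and g1: "path_image g1 \<subseteq> X" "stabs_horizontally g1 0 a 0 1"
    and g2: "path_image g2 \<subseteq> X" "stabs_vertically g2 (a + w) 1 b (b + w)"
    using X \<delta> unfolding anchored_position_def by (auto dest!: bspec[of _ _ \<delta>])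
  have E': "0 \<le> a" "0 < b" "b + w < 1"
    using subsetD[OF E(2), of "(a, b)"] subsetD[OF E(2), of "(a, b + w)"] E(1)
    by (auto simp: rectangle_def unit_strip_def)
  text \<open>\<open>o'\<close> is the slight contraction of the inner family, and \<open>bx p\<close> the box of the new
    copy \<open>D p\<close> of \<open>X\<close>.\<close>
  define o' where "o' = (0::real, 0::real, \<sigma>)"
  \<comment> \<open>Half the side of the contracted core: the box of \<open>D p\<close> takes the
    lower half of its levels and touches the right side of the unit square.\<close>
  define s where "s = (\<lambda>p::real\<times>real\<times>real. \<sigma> * snd (snd p) / 2)"
  define bx where "bx = (\<lambda>p. (1 - s p, \<sigma> * fst (snd p), s p))"
  define D where "D = (\<lambda>p. place (bx p) ` X)"
  \<comment> \<open>\<open>low p\<close> is the image of the empty square of \<open>X\<close>, and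
    \<open>up p\<close> is the upper right quarter of the contracted core.\<close>
  define low where "low = (\<lambda>p. comb (bx p) (a, b, w))"
  define up where "up = (\<lambda>p. (\<sigma> * fst p + s p, \<sigma> * fst (snd p) + s p, s p))"
  define G where "G = (`) (place o') ` F \<union> D ` P"
  define R where "R = low ` P \<union> up ` P"
  have o': "0 < snd (snd o')" using \<sigma> by (simp add: o'_def)

  \<comment> \<open>The third fact bounds the margin of \<open>up p\<close>: the gap and the
    contracted margin of \<open>p\<close> add up to at most \<open>3/16\<close> of
    \<open>\<epsilon> * \<sigma> * h\<close>. The next two place the left side of the box within the
    horizontal extent of the contracted core, and the last puts the empty square inside the
    gap.\<close>
  have num: "0 < s p" "s p \<le> 1 / 2" "1 - \<sigma> * (fst p + snd (snd p)) \<le> \<epsilon> * s p"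
    "1 - s p \<le> \<sigma> * (fst p + snd (snd p))" "\<sigma> * fst p \<le> 1 - s p" "\<sigma> < 1 - s p + s p * a"
    if p: "p \<in> P" for p
  proof -
    obtain x y h where xyh: "p = (x, y, h)" by (cases p)
    have pr: "0 < h" "0 \<le> x" "x + h \<le> 1" "0 < y" "y + h < 1" "1 - (x + h) \<le> \<epsilon> / 8 * h"
      using config_probe[OF F(1) p] xyh by auto
    show s: "0 < s p" using pr \<sigma> by (auto simp: s_def xyh)
    have "\<sigma> * h \<le> 1 * 1" using pr \<sigma> by (intro mult_mono) auto
    then show s': "s p \<le> 1 / 2" by (simp add: s_def xyh)
    have "\<epsilon> * \<eta> \<le> \<epsilon> * h" using \<epsilon> \<eta>(3) p xyh by (intro mult_left_mono) auto
    moreover have "\<epsilon> * h * (1 / 2) \<le> \<epsilon> * h * \<sigma>" using \<epsilon> pr \<sigma> by (intro mult_left_mono) auto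
    ultimately have "\<delta> \<le> \<epsilon> * h * \<sigma> / 16" by (simp add: \<delta>_def)
    moreover have "\<sigma> * (1 - (x + h)) \<le> \<sigma> * (\<epsilon> / 8 * h)"
      using pr \<sigma> by (intro mult_left_mono) auto
    moreover have "1 - \<sigma> * (x + h) = \<delta> + \<sigma> * (1 - (x + h))" by (simp add: \<sigma>_def algebra_simps)
    moreover have "0 \<le> \<epsilon> * h * \<sigma>" using \<epsilon> pr \<sigma> by simp
    ultimately have "1 - \<sigma> * (x + h) \<le> \<epsilon> * (\<sigma> * h / 2)" by (simp add: algebra_simps)
    then show n1: "1 - \<sigma> * (fst p + snd (snd p)) \<le> \<epsilon> * s p" by (simp add: s_def xyh)
    have "\<epsilon> * s p \<le> 1 * s p" using \<epsilon> s by (intro mult_right_mono) auto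
    then show "1 - s p \<le> \<sigma> * (fst p + snd (snd p))" using n1 by linarith
    have "\<sigma> * (x + h) \<le> 1 * 1" using pr \<sigma> by (intro mult_mono) auto
    then have "\<sigma> * x + 2 * s p \<le> 1" by (simp add: s_def xyh algebra_simps)
    then show "\<sigma> * fst p \<le> 1 - s p" using s xyh by simp
    have "1 - a < \<delta>" using E(4,5) by (simp add: algebra_simps)
    then have "s p * (1 - a) < s p * \<delta>" using s by simp
    also have "\<dots> \<le> 1 * \<delta>" using s' \<delta> by (intro mult_right_mono) auto
    finally show "\<sigma> < 1 - s p + s p * a" by (simp add: \<sigma>_def algebra_simps)
  qed
  have up_nested: "nested (up p) (comb o' p)" if "p \<in> P" for p
    using num[OF that] by (cases p) (auto simp: up_def o'_def s_def algebra_simps)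
  have comb_probe: "0 < snd (snd (comb o' p))" if "p \<in> P" for p
    using probe_pos[OF config_probe[OF F(1) that]] o' by (cases p) (auto simp: o'_def)
  have prb: "probe \<epsilon> (up p)" "probe \<epsilon> (low p)" if p: "p \<in> P" for p
  proof -
    obtain x y h where xyh: "p = (x, y, h)" by (cases p)
    have pr: "0 < h" "0 \<le> x" "x + h \<le> 1" "0 < y" "y + h < 1"
      using config_probe[OF F(1) p] xyh by auto
    note n = num[OF p]
    have s2: "2 * s p = \<sigma> * h" by (simp add: s_def xyh)
    have y: "0 < \<sigma> * y" "\<sigma> * (y + h) < 1 * 1" "0 \<le> \<sigma> * x" "\<sigma> * (x + h) \<le> 1 * 1"
      using pr \<sigma> by (intro mult_strict_mono mult_mono mult_pos_pos mult_nonneg_nonneg; simp)+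
    show "probe \<epsilon> (up p)"
      using n y s2 by (auto simp: up_def xyh distrib_left)
    have "s p * b > 0" "s p * w > 0" "s p * a \<ge> 0" using n E E' by auto
    moreover have "s p * (b + w) < s p * 1" using E' n by (intro mult_strict_left_mono) auto
    moreover have aw: "s p * (1 - (a + w)) = \<delta> * (s p * w)" unfolding E(5) by simp
    moreover have "\<delta> * (s p * w) \<le> \<epsilon> * (s p * w)" using \<delta>\<epsilon> n E by (intro mult_right_mono) auto
    moreover have "0 \<le> \<delta> * (s p * w)" using \<delta> n E by simp
    ultimately show "probe \<epsilon> (low p)"
      using n y s2 by (auto simp: low_def bx_def xyh algebra_simps)
  qed
  have low_nested: "nested (low p) (bx p)" if "p \<in> P" for p
  proof -
    have "0 \<le> \<delta> * w" "\<delta> * w \<le> 1 * w" using E(1) \<delta> by (auto intro!: mult_right_mono simp del: mult_1)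
    then have "probe 1 (a, b, w)" using E E' by simp
    moreover have "0 < snd (snd (bx p))" using num(1)[OF that] by (simp add: bx_def)
    ultimately show ?thesis unfolding low_def using nested_comb by blast
  qed
  have bx_levels: "levels (bx p) \<subseteq> levels (comb o' p)" if "p \<in> P" for p
  proof -
    have "0 < snd (snd p)" "0 < \<sigma>" using probe_pos[OF config_probe[OF F(1) that]] \<sigma> by auto
    then show ?thesis by (cases p) (simp add: bx_def o'_def s_def)
  qed
  have R_levels: "levels (up p) \<subseteq> levels (comb o' p)" "levels (low p) \<subseteq> levels (comb o' p)"
    if "p \<in> P" for p
    using nested_levels[OF up_nested] nested_levels[OF low_nested] bx_levels that by blast+
  have plev: "p = q" if "p \<in> P" "q \<in> P" "levels (comb o' p) \<inter> levels (comb o' q) \<noteq> {}" for p q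
    using config_levels[OF F(1)] comb_levels_Int[OF o'] that by blast
  have D_sub: "D p \<subseteq> {1 - s p..1} \<times> {\<sigma> * fst (snd p)<..<\<sigma> * fst (snd p) + s p}" if "p \<in> P" for p
    using place_unit_strip[OF num(1)[OF that] Xu, of "1 - s p" "\<sigma> * fst (snd p)"]
    by (simp add: D_def bx_def)
  have D_strip: "D p \<subseteq> strip (comb o' p)" if "p \<in> P" for p
    using D_sub[OF that] num[OF that] by (cases p) (fastforce simp: o'_def s_def)
  have F_sub: "place o' ` A \<subseteq> {..\<sigma>} \<times> UNIV" if "A \<in> F" for A
    using place_unit_strip_core[OF o' config_unit_strip[OF F(1) that]] by (auto simp: o'_def)
  have low_sub: "strip (low p) \<subseteq> {\<sigma><..} \<times> UNIV" if "p \<in> P" for p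
    using num(6)[OF that] by (auto simp: low_def bx_def)
  have F_low: "place o' ` A \<inter> strip (low p) = {}" if "A \<in> F" "p \<in> P" for A p
    using F_sub[OF that(1)] low_sub[OF that(2)] by fastforce
  \<comment> \<open>\<open>D p\<close> lies in the strip of its own contracted probe, and distinct
    probes have disjoint levels.\<close>
  have D_strips: "p = q" if "p \<in> P" "q \<in> P" "D p \<inter> strip r \<noteq> {}" "levels r \<subseteq> levels (comb o' q)" for p q r
  proof (rule plev[OF that(1,2)])
    from that(3) obtain z where z: "z \<in> D p" "z \<in> strip r" by blast
    then show "levels (comb o' p) \<inter> levels (comb o' q) \<noteq> {}"
      using strip_levels[of z r] strip_levels[of z "comb o' p"] D_strip[OF that(1)] that(4) by blast
  qed
  have DD: "p = q" if "p \<in> P" "q \<in> P" "D p \<inter> D q \<noteq> {}" for p q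
    using D_strips[OF that(1,2), of "comb o' q"] D_strip[OF that(2)] that(3) by blast
  \<comment> \<open>For \<open>p = q\<close> the open top of the box is decisive: \<open>D p\<close>
    stays strictly below the bottom of \<open>up p\<close>.\<close>
  have D_up: "D p \<inter> strip (up q) = {}" if "p \<in> P" "q \<in> P" for p q
  proof (rule ccontr)
    assume ne: "D p \<inter> strip (up q) \<noteq> {}"
    then have "p = q" using D_strips[OF that] R_levels that by blast
    with ne D_sub[OF that(1)] show False by (cases p) (fastforce simp: up_def)
  qed
  have D_crosses: "crosses (D p) (low p)" if "p \<in> P" for p
  proof -
    have "crosses X (a, b, w)"
      using g2 unfolding stabs_vertically_def crosses.simps
      by (intro exI[of _ g2]) (auto simp: rectangle_def)
    then show ?thesis
      unfolding D_def low_def using num(1)[OF that] by (intro crosses_place) (auto simp: bx_def)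
  qed
  have met_low: "met G (low p) = {D p}" if p: "p \<in> P" for p
  proof -
    have "D p \<inter> strip (low p) \<noteq> {}" using crosses_meets_strip D_crosses prb p by blast
    moreover have "q = p" if "q \<in> P" "D q \<inter> strip (low p) \<noteq> {}" for q
      using D_strips[OF that(1) p that(2)] R_levels p by blast
    ultimately show ?thesis using F_low p unfolding met_def G_def by blast
  qed
  have F_crosses: "crosses (place o' ` A) (comb o' p)" if "p \<in> P" "A \<in> met F p" for A p
    using crosses_place[OF o'] config_crosses[OF F(1)] that by blast
  have met_up: "met G (up p) = (`) (place o') ` met F p" if p: "p \<in> P" for p
  proof (intro equalityI subsetI)
    fix A assume A: "A \<in> met G (up p)"
    then obtain B where B: "B \<in> F" "A = place o' ` B" using D_up p unfolding met_def G_def by blast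
    then have "A \<inter> strip (comb o' p) \<noteq> {}"
      using A nested_strip[OF up_nested[OF p]] unfolding met_def by blast
    then show "A \<in> (`) (place o') ` met F p" using place_strip_Int[OF o'] B by (auto simp: met_def)
  next
    fix A assume "A \<in> (`) (place o') ` met F p"
    then obtain B where B: "B \<in> met F p" "A = place o' ` B" by blast
    then have "crosses A (up p)" using F_crosses p nested_crosses up_nested by blast
    then show "A \<in> met G (up p)"
      using crosses_meets_strip[OF _ prb(1)] p B by (auto simp: met_def G_def)
  qed
  have D_meets: "D p \<inter> place o' ` A \<noteq> {}" "D p \<noteq> place o' ` A" if p: "p \<in> P" and A: "A \<in> met F p" for p A
  proof -
    have AF: "A \<in> F" using A by (simp add: met_def)
    obtain x y h where xyh: "p = (x, y, h)" by (cases p)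
    note n = num[OF p]
    have s2: "2 * s p = \<sigma> * h" by (simp add: s_def xyh)
    obtain g where g: "path g" "path_image g \<subseteq> place o' ` A \<inter> {\<sigma> * x + \<sigma> * h..} \<times> UNIV"
      "\<sigma> * y + \<sigma> * h \<le> snd (pathstart g)" "snd (pathfinish g) \<le> \<sigma> * y"
      using F_crosses[OF p A] by (auto simp: xyh o'_def)
    \<comment> \<open>The horizontal curve of the new copy runs from the left side of its box to the
      left side of its empty square. The crossing curve \<open>g\<close> of \<open>A\<close> lies
      between these two sides: right of the core, and left of the gap.\<close>
    define f where "f = place (bx p) \<circ> g1"
    have "path f"
      using g1(2) unfolding f_def bx_def path_def comp_def place.simps stabs_horizontally_def
      by (intro continuous_intros) auto
    have fD: "path_image f \<subseteq> D p" using g1(1) by (auto simp: f_def D_def path_image_compose)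
    have fe: "fst (pathstart f) = 1 - s p" "fst (pathfinish f) = 1 - s p + s p * a"
      using g1(2) by (auto simp: f_def bx_def pathstart_compose pathfinish_compose stabs_horizontally_def)
    have "path_image f \<subseteq> {..1 - s p + s p * a} \<times> UNIV"
      using g1(2) n by (force simp: f_def bx_def path_image_compose stabs_horizontally_def rectangle_def)
    then have fb: "path_image f \<subseteq> {1 - s p..1 - s p + s p * a} \<times> {\<sigma> * y<..<\<sigma> * y + \<sigma> * h}"
      using fD D_sub[OF p] n(1) s2 xyh by fastforce
    have "path_image g \<subseteq> {1 - s p..1 - s p + s p * a} \<times> UNIV"
      using g(2) F_sub[OF AF] n xyh by (fastforce simp: distrib_left)
    then have "path_image f \<inter> path_image g \<noteq> {}"
      using curves_cross[OF \<open>path f\<close> fb fe g(1)] g by blast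
    then show "D p \<inter> place o' ` A \<noteq> {}" using fD g(2) by blast
    \<comment> \<open>The right end of \<open>f\<close> is inside the gap, beyond the contracted
      family, so the two sets differ.\<close>
    have "pathfinish f \<in> D p" using fD by blast
    moreover have "pathfinish f \<notin> place o' ` A"
    proof
      assume "pathfinish f \<in> place o' ` A"
      then have "fst (pathfinish f) \<le> \<sigma>" using F_sub[OF AF] by fastforce
      then show False using fe n by linarith
    qed
    ultimately show "D p \<noteq> place o' ` A" by blast
  qed
  have place_Int: "place o' ` B \<inter> place o' ` C = {} \<longleftrightarrow> B \<inter> C = {}" for B C
    using inj_place[OF o'] by (rule image_Int_empty_iff)
  have DF: "A \<in> met F p" if "p \<in> P" "A \<in> F" "D p \<inter> place o' ` A \<noteq> {}" for p A
    using that D_strip[OF that(1)] place_strip_Int[OF o', of A p] unfolding met_def by blast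
  have "config X \<epsilon> G R"
    unfolding config_def
  proof (intro conjI ballI impI)
    show "finite G" "finite R" using config_finite[OF F(1)] by (auto simp: G_def R_def)
  next
    have "homothetic_copy X A \<and> A \<subseteq> unit_strip" if "A \<in> G" for A
    proof -
      from that consider B where "B \<in> F" "A = place o' ` B" | p where "p \<in> P" "A = D p"
        by (auto simp: G_def)
      then show ?thesis
      proof cases
        case 1
        have "A \<subseteq> {0..0 + \<sigma>} \<times> {0<..<0 + \<sigma>}"
          unfolding 1(2) o'_def using config_unit_strip[OF F(1) 1(1)] \<sigma> by (intro place_unit_strip) auto
        then have "A \<subseteq> unit_strip" using \<sigma> by (fastforce simp: unit_strip_def)
        then show ?thesis using homothetic_copy_place[OF config_copy[OF F(1) 1(1)] o'] 1(2) by blast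
      next
        case 2
        have "homothetic_copy X A"
          unfolding 2(2) D_def using num(1)[OF 2(1)]
          by (intro homothetic_copy_place homothetic_copy_refl) (simp add: bx_def)
        moreover have "A \<subseteq> unit_strip"
        proof -
          obtain x y h where xyh: "p = (x, y, h)" by (cases p)
          have "probe \<epsilon> (up p)" using prb 2 by blast
          then have "\<sigma> * y + 2 * s p < 1" by (simp add: up_def xyh)
          moreover have "0 < \<sigma> * y" using config_probe[OF F(1) 2(1)] \<sigma> xyh by auto
          ultimately show ?thesis
            using D_sub[OF 2(1)] num[OF 2(1)] unfolding 2(2) xyh by (fastforce simp: unit_strip_def)
        qed
        ultimately show ?thesis by blast
      qed
    qed
    then show "homothetic_copy X A" "A \<subseteq> unit_strip" if "A \<in> G" for A
      using that by blast+
  next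
    have DD': "A = B" if "A \<in> D ` P" "B \<in> D ` P" "A \<inter> B \<noteq> {}" for A B
      using that DD by blast
    \<comment> \<open>All members of the contracted family that meet \<open>D p\<close> come from
      \<open>met F p\<close>, which is pairwise disjoint.\<close>
    have DFF: "B \<inter> C = {}" if "A \<in> D ` P" "B \<in> (`) (place o') ` F" "C \<in> (`) (place o') ` F"
      "A \<inter> B \<noteq> {}" "A \<inter> C \<noteq> {}" "B \<noteq> C" for A B C
    proof -
      from that(1-3) obtain p B' C' where *: "p \<in> P" "A = D p" "B' \<in> F" "B = place o' ` B'"
          "C' \<in> F" "C = place o' ` C'"
        by blast
      then have "B' \<in> met F p" "C' \<in> met F p" "B' \<noteq> C'" using that(4-6) DF by auto
      then show ?thesis using config_disjnt[OF F(1)] * place_Int by blast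
    qed
    have FFF: "triangle_free_family ((`) (place o') ` F)"
      using triangle_free_family_image inj_place[OF o'] config_triangle_free[OF F(1)] by blast
    show "triangle_free_family G"
      unfolding triangle_free_family_def
    proof (intro notI, elim bexE conjE)
      fix A B C assume H: "A \<in> G" "B \<in> G" "C \<in> G" and ne: "A \<noteq> B" "B \<noteq> C" "A \<noteq> C"
        and int: "A \<inter> B \<noteq> {}" "B \<inter> C \<noteq> {}" "A \<inter> C \<noteq> {}"
      consider "A \<in> (`) (place o') ` F" "B \<in> (`) (place o') ` F" "C \<in> (`) (place o') ` F"
        | "A \<in> D ` P" "B \<in> (`) (place o') ` F" "C \<in> (`) (place o') ` F"
        | "B \<in> D ` P" "A \<in> (`) (place o') ` F" "C \<in> (`) (place o') ` F"
        | "C \<in> D ` P" "A \<in> (`) (place o') ` F" "B \<in> (`) (place o') ` F"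
        | "A \<in> D ` P" "B \<in> D ` P" | "A \<in> D ` P" "C \<in> D ` P" | "B \<in> D ` P" "C \<in> D ` P"
        using H unfolding G_def by blast
      then show False
      proof cases
        case 1 then show ?thesis using triangle_free_familyD[OF FFF] ne int by blast
      next
        case 2 then show ?thesis using DFF[of A B C] ne int by blast
      next
        case 3 then show ?thesis using DFF[of B A C] ne int by (simp add: Int_commute)
      next
        case 4 then show ?thesis using DFF[of C A B] ne int by (simp add: Int_commute)
      qed (use DD' ne int in blast)+
    qed
  next
    fix r assume "r \<in> R"
    then obtain p where p: "p \<in> P" and r: "r = up p \<or> r = low p" by (auto simp: R_def)
    show "probe \<epsilon> r" using prb p r by blast
    show "A \<inter> core r = {}" if A: "A \<in> G" for A
    proof (rule ccontr)
      assume ne: "A \<inter> core r \<noteq> {}"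
      then have m: "A \<in> met G r" using A core_strip[of r] unfolding met_def by blast
      from r show False
      proof
        assume r: "r = up p"
        then obtain B where "B \<in> F" "A = place o' ` B" using m met_up[OF p] unfolding met_def by blast
        then show False
          using ne nested_core[OF up_nested[OF p]] place_core_Int[OF o', of B p] config_core[OF F(1) p] r by blast
      next
        assume r: "r = low p"
        then have "A = D p" using m met_low[OF p] by blast
        moreover have "X \<inter> core (a, b, w) = {}" using E(3) by (auto simp: rectangle_def)
        ultimately show False
          using ne r place_core_Int[of "bx p" X "(a, b, w)"] num(1)[OF p] unfolding D_def low_def bx_def by auto
      qed
    qed
    show "crosses A r" if "A \<in> met G r" for A
      using that r met_up[OF p] met_low[OF p] D_crosses[OF p] F_crosses[OF p] nested_crosses[OF up_nested[OF p]]
      by auto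
    show "pairwise disjnt (met G r)"
      using r
    proof
      assume "r = up p"
      moreover have "disjnt (place o' ` A) (place o' ` B)"
        if "A \<in> met F p" "B \<in> met F p" "place o' ` A \<noteq> place o' ` B" for A B
        using that config_disjnt[OF F(1) p, of A B] place_Int[of A B] unfolding disjnt_def by blast
      ultimately show ?thesis
        by (simp add: met_up[OF p] pairwise_def)
    next
      assume "r = low p"
      then show ?thesis using met_low[OF p] by simp
    qed
    fix r' assume "r' \<in> R" "r \<noteq> r'"
    then obtain q where q: "q \<in> P" and r': "r' = up q \<or> r' = low q" by (auto simp: R_def)
    \<comment> \<open>The empty square ends strictly below the top of the box, where
      \<open>up p\<close> begins.\<close>
    have ul: "levels (up p) \<inter> levels (low p) = {}"
    proof -
      have "s p * (b + w) < s p * 1" using E' num(1)[OF p] by (intro mult_strict_left_mono) auto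
      then show ?thesis by (cases p) (auto simp: up_def low_def bx_def distrib_left)
    qed
    show "levels r \<inter> levels r' = {}"
    proof (cases "p = q")
      case True
      then show ?thesis using ul r r' \<open>r \<noteq> r'\<close> by blast
    next
      case False
      then have "levels (comb o' p) \<inter> levels (comb o' q) = {}" using plev p q by blast
      then show ?thesis using R_levels[OF p] R_levels[OF q] r r' by blast
    qed
  qed
  moreover have "extends k G R"
    unfolding extends_def
  proof (intro allI impI)
    fix c S assume c: "proper G c" and S: "finite (S :: nat set)" "k \<le> card S"
    have "proper F (\<lambda>A. c (place o' ` A))"
      using c inj_place[OF o'] by (intro proper_place[of G]) (auto simp: G_def)
    then obtain p where p: "p \<in> P" "k \<le> card ((\<lambda>A. c (place o' ` A)) ` met F p)"
      using F(2) by (auto simp: forces_def)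
    let ?C = "(\<lambda>A. c (place o' ` A)) ` met F p"
    have up: "c ` met G (up p) = ?C" using met_up[OF p(1)] by (simp add: image_image)
    have fin: "finite ?C" using config_finite(1)[OF F(1)] by (simp add: met_def)
    show "\<exists>r\<in>R. Suc k \<le> card (S \<union> c ` met G r)"
    proof (cases "Suc k \<le> card (S \<union> ?C)")
      case True
      then show ?thesis using p up by (intro bexI[of _ "up p"]) (auto simp: R_def)
    next
      case False
      \<comment> \<open>The union has at most \<open>k\<close> colours and each of the two sets at
        least \<open>k\<close>, so both equal the union.\<close>
      then have "card (S \<union> ?C) \<le> card S" "card (S \<union> ?C) \<le> card ?C" using S p by auto
      then have "S = S \<union> ?C" "?C = S \<union> ?C"
        using S fin by (intro card_seteq; simp)+
      then have "S = ?C" by blast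
      moreover have "c (D p) \<noteq> c (place o' ` A)" if "A \<in> met F p" for A
        using c D_meets[OF p(1) that] p(1) that by (auto simp: proper_def G_def met_def)
      ultimately have "c (D p) \<notin> S" by auto
      then have "Suc k \<le> card (S \<union> c ` met G (low p))"
        using S met_low[OF p(1)] by simp
      then show ?thesis using p by (auto simp: R_def)
    qed
  qed
  ultimately show ?thesis by blast
qed

section \<open>Induction on the number of forced colours\<close>

text \<open>\<epsilon> varies in the induction because the hypothesis is used twice, with different
  parameters. The inner family comes first, as its smallest core determines how thin the outer
  probes must be.\<close>

lemma ex_forcing_config:
  assumes "anchored_position X" "0 < \<epsilon>" "\<epsilon> \<le> 1"
  shows "\<exists>F P. config X \<epsilon> F P \<and> forces k F P"
  using assms(2,3)
proof (induction k arbitrary: \<epsilon>)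
  case 0
  \<comment> \<open>The core touches the right side of the unit square, so its margin is
    \<open>0\<close> and any positive \<epsilon> is met.\<close>
  have "config X \<epsilon> {} {(3 / 4, 1 / 4, 1 / 4)}"
    using 0 by (simp add: config_def triangle_free_family_def met_def pairwise_def)
  moreover have "forces 0 {} {(3 / 4, 1 / 4, 1 / 4)}"
    by (simp add: forces_def)
  ultimately show ?case by blast
next
  case (Suc k)
  then have "0 < \<epsilon> / 2 / 8" "\<epsilon> / 2 / 8 \<le> 1" by auto
  then obtain F0 P0 where "config X (\<epsilon> / 2 / 8) F0 P0" "forces k F0 P0"
    using Suc.IH by blast
  then obtain G R where G: "config X (\<epsilon> / 2) G R" "extends k G R"
    using config_extend[OF assms(1), of "\<epsilon> / 2"] Suc.prems by fastforce
  then obtain \<eta> where \<eta>: "0 < \<eta>" "\<eta> \<le> 1" "\<And>x y h. (x, y, h) \<in> R \<Longrightarrow> \<eta> \<le> h"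
    using config_width_bound by metis
  have "\<eta> * (\<epsilon> / 2) \<le> 1 * 1" using \<eta> Suc.prems by (intro mult_mono) auto
  then obtain F P where F: "config X (\<eta> * (\<epsilon> / 2)) F P" "forces k F P"
    using Suc.IH[of "\<eta> * (\<epsilon> / 2)"] \<eta> Suc.prems by auto
  have "\<eta> * (\<epsilon> / 2) \<le> h * (\<epsilon> - \<epsilon> / 2)" if "(x, y, h) \<in> R" for x y h
    using \<eta>(3)[OF that] Suc.prems by (auto intro: mult_right_mono)
  then show ?case using config_insert[OF F G] by blast
qed

section \<open>Return from the anchored position to the given set\<close>

text \<open>Conjugating a homothety by an affine map gives a homothety of the same ratio;
  \<open>e\<close> below is the new translation vector.\<close>

lemma homothetic_copy_inv_affine:
  assumes "invertible_affine T" "homothetic_copy (T ` X) Y"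
  shows "homothetic_copy X (inv T ` Y)"
proof -
  obtain f d where f: "linear f" "bij f" and T: "T = (\<lambda>x. f x + d)"
    using assms(1) by (auto simp: invertible_affine_def)
  obtain r c where r: "r > 0" "Y = (\<lambda>x. r *\<^sub>R x + c) ` T ` X"
    using assms(2) by (auto simp: homothetic_copy_def)
  obtain e where e: "f e = r *\<^sub>R d + c - d" using f(2) by (metis bij_pointE)
  have inj: "inj T" using f(2) by (auto simp: T inj_def bij_def)
  have "r *\<^sub>R T x + c = T (r *\<^sub>R x + e)" for x
    using f(1) e by (simp add: T linear_add linear_scale algebra_simps)
  then have "inv T ` Y = (\<lambda>x. r *\<^sub>R x + e) ` X"
    using inj r by (simp add: image_image)
  then show ?thesis using r(1) by (auto simp: homothetic_copy_def)
qed

lemma bij_invertible_affine: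
  assumes "invertible_affine T"
  shows "bij T"
proof -
  obtain f d where f: "bij f" and T: "T = (\<lambda>x. f x + d)"
    using assms by (auto simp: invertible_affine_def)
  have "T = (\<lambda>x. x + d) \<circ> f" using T by auto
  moreover have "bij (\<lambda>x. x + d)" by (rule bij_betw_byWitness[of _ "\<lambda>x. x - d"]) auto
  ultimately show ?thesis using f bij_comp by metis
qed

theorem theorem5:
  fixes X :: "(real \<times> real) set" and k :: nat
  assumes "anchored X" and "k \<ge> 1"
  shows "\<exists>F. (\<forall>Y\<in>F. homothetic_copy X Y) \<and> triangle_free_family F \<and>
             family_chromatic_number F > enat k"
proof -
  obtain T where T: "invertible_affine T" "anchored_position (T ` X)"
    using assms by (auto simp: anchored_def)
  \<comment> \<open>\<open>Suc k\<close> forced colours yield the strict inequality.\<close>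
  then obtain F P where F: "config (T ` X) 1 F P" "forces (Suc k) F P"
    using ex_forcing_config[OF T(2) zero_less_one order_refl, of "Suc k"] by blast
  define H where "H = (`) (inv T) ` F"
  have inj: "inj (inv T)"
    using bij_invertible_affine[OF T(1)] bij_imp_bij_inv bij_is_inj by blast
  have "enat (Suc k) \<le> enat n" if "proper_colouring H (intersection_edges H) n c" for n c
  proof -
    have "proper H c"
      using that unfolding proper_def proper_colouring_def intersection_edges_def by blast
    then have "proper F (\<lambda>A. c (inv T ` A))"
      using inj by (intro proper_place[of H]) (auto simp: H_def)
    then obtain p where "Suc k \<le> card ((\<lambda>A. c (inv T ` A)) ` met F p)"
      using F(2) by (auto simp: forces_def)
    also have "\<dots> \<le> card {..<n}"
      using that by (intro card_mono) (auto simp: proper_colouring_def H_def met_def)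
    finally show ?thesis by simp
  qed
  then have "enat (Suc k) \<le> family_chromatic_number H"
    unfolding family_chromatic_number_def chromatic_number_def by (intro INF_greatest) auto
  then have "enat k < family_chromatic_number H"
    by (rule less_le_trans[rotated]) simp
  moreover have "triangle_free_family H"
    unfolding H_def using triangle_free_family_image inj config_triangle_free[OF F(1)] by blast
  moreover have "\<forall>Y\<in>H. homothetic_copy X Y"
    using homothetic_copy_inv_affine[OF T(1)] config_copy[OF F(1)] by (auto simp: H_def)
  ultimately show ?thesis by blast
qed

end
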